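(* Let $\ell,m\ge1$ be integers and let $(w_{jk})_{1\le j\le\ell,\,1\le k\le m}$ be nonnegative integers such that every row sum $w_{j+}:=\sum_k w_{jk}$ and every column sum $\sum_j w_{jk}$ is strictly positive; let $n:=\sum_{j,k}w_{jk}$. For $\boldsymbol a\in[0,\infty)^{\ell\times m}$ let $$L_{\rm raw}(\boldsymbol a):=\sum_{j=1}^\ell\sum_{k=1}^m w_{jk}\log a_{jk},\qquad L(\boldsymbol a):=L_{\rm raw}(\boldsymbol a)-n\sum_{j=1}^{\ell}\sum_{k=1}^m a_{jk}+n,$$ and consider the constraints $$\text{(N)}\quad \sum_{k=1}^m a_{jk}=1\ \text{ for }1\le j\le\ell,$$ $$\text{(LR)}\quad a_{j_1k_2}a_{j_2k_1}\le a_{j_1k_1}a_{j_2k_2}\ \text{ for }1\le j_1<j_2\le\ell,\ 1\le k_1<k_2\le m.$$ Then: - If $\hat{\boldsymbol h}$ is a maximizer of $L(\boldsymbol h)$ over all $\boldsymbol h\in[0,\infty)^{\ell\times m}$ satisfying (LR), then $\hat h_{j+}:=\sum_k\hat h_{jk}=w_{j+}/n$ for all $j$, and $\hat q_{jk}:=\hat h_{jk}/\hat h_{j+}$ defines a maximizer $\hat{\boldsymbol q}$ of $L_{\rm raw}(\boldsymbol q)$ over all $\boldsymbol q\in[0,1]^{\ell\times m}$ satisfying (N) and (LR). - If $\hat{\boldsymbol q}$ is a maximizer of $L_{\rm raw}(\boldsymbol q)$ over all $\boldsymbol q\in[0,1]^{\ell\times m}$ satisfying (N) and (LR), then $\hat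 h_{jk}:=(w_{j+}/n)\hat q_{jk}$ defines a maximizer $\hat{\boldsymbol h}$ of $L(\boldsymbol h)$ over all $\boldsymbol h\in[0,\infty)^{\ell\times m}$ satisfying (LR).
   Context: Conventions: $\log 0:=-\infty$ and $0\cdot\log 0:=0$, so $L_{\rm raw}$ and $L$ take values in $[-\infty,\infty)$. The $w_{jk}$ are the counts $w_{jk}=\#\{i:(X_i,Y_i)=(x_j,y_k)\}$ of $n$ observations, where $x_1<\dots<x_\ell$ and $y_1<\dots<y_m$ are the distinct observed values of the $X_i$ and of the $Y_i$ (so all row and column sums are positive). *)

theory Defs
  imports "HOL-Analysis.Analysis"
begin

text \<open>
  An \<open>l \<times> m\<close> matrix is a function \<open>nat \<Rightarrow> nat \<Rightarrow> _\<close> of which only the entries with indices in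
  \<open>{1..l} \<times> {1..m}\<close> are ever inspected.
\<close>

text \<open>
  The convention \<open>log 0 = -\<infinity>\<close> has to be made explicit, since \<open>ln 0 = 0\<close> for the library's real
  logarithm; the value at negative arguments is irrelevant. The convention
  \<open>0 \<cdot> log 0 = 0\<close> is the library's \<open>0 * (-\<infinity>) = 0\<close> on \<^typ>\<open>ereal\<close>.
\<close>
definition elog :: "real \<Rightarrow> ereal" where
  "elog x = (if 0 < x then ereal (ln x) else -\<infinity>)"

definition row_sum :: "nat \<Rightarrow> (nat \<Rightarrow> nat \<Rightarrow> 'a::comm_monoid_add) \<Rightarrow> nat \<Rightarrow> 'a" where
  "row_sum m a j = (\<Sum>k=1..m. a j k)"

definition col_sum :: "nat \<Rightarrow> (nat \<Rightarrow> nat \<Rightarrow> 'a::comm_monoid_add) \<Rightarrow> nat \<Rightarrow> 'a" where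
  "col_sum l a k = (\<Sum>j=1..l. a j k)"

definition total_sum :: "nat \<Rightarrow> nat \<Rightarrow> (nat \<Rightarrow> nat \<Rightarrow> 'a::comm_monoid_add) \<Rightarrow> 'a" where
  "total_sum l m a = (\<Sum>j=1..l. \<Sum>k=1..m. a j k)"

definition L_raw :: "nat \<Rightarrow> nat \<Rightarrow> (nat \<Rightarrow> nat \<Rightarrow> nat) \<Rightarrow> (nat \<Rightarrow> nat \<Rightarrow> real) \<Rightarrow> ereal" where
  "L_raw l m w a = (\<Sum>j=1..l. \<Sum>k=1..m. ereal (real (w j k)) * elog (a j k))"

definition L_fun :: "nat \<Rightarrow> nat \<Rightarrow> (nat \<Rightarrow> nat \<Rightarrow> nat) \<Rightarrow> (nat \<Rightarrow> nat \<Rightarrow> real) \<Rightarrow> ereal" where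
  "L_fun l m w a =
     L_raw l m w a - ereal (real (total_sum l m w) * total_sum l m a)
       + ereal (real (total_sum l m w))"

definition entries_in :: "nat \<Rightarrow> nat \<Rightarrow> real set \<Rightarrow> (nat \<Rightarrow> nat \<Rightarrow> real) \<Rightarrow> bool" where
  "entries_in l m S a \<longleftrightarrow> (\<forall>j\<in>{1..l}. \<forall>k\<in>{1..m}. a j k \<in> S)"

definition normalized :: "nat \<Rightarrow> nat \<Rightarrow> (nat \<Rightarrow> nat \<Rightarrow> real) \<Rightarrow> bool" where
  "normalized l m a \<longleftrightarrow> (\<forall>j\<in>{1..l}. row_sum m a j = 1)"

definition LR_ordered :: "nat \<Rightarrow> nat \<Rightarrow> (nat \<Rightarrow> nat \<Rightarrow> real) \<Rightarrow> bool" where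
  "LR_ordered l m a \<longleftrightarrow>
     (\<forall>j1 j2 k1 k2. 1 \<le> j1 \<and> j1 < j2 \<and> j2 \<le> l \<and> 1 \<le> k1 \<and> k1 < k2 \<and> k2 \<le> m \<longrightarrow>
        a j1 k2 * a j2 k1 \<le> a j1 k1 * a j2 k2)"

definition maximizes_L :: "nat \<Rightarrow> nat \<Rightarrow> (nat \<Rightarrow> nat \<Rightarrow> nat) \<Rightarrow> (nat \<Rightarrow> nat \<Rightarrow> real) \<Rightarrow> bool" where
  "maximizes_L l m w h \<longleftrightarrow>
     is_arg_max (L_fun l m w) (\<lambda>a. entries_in l m {0..} a \<and> LR_ordered l m a) h"

definition maximizes_L_raw :: "nat \<Rightarrow> nat \<Rightarrow> (nat \<Rightarrow> nat \<Rightarrow> nat) \<Rightarrow> (nat \<Rightarrow> nat \<Rightarrow> real) \<Rightarrow> bool" where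
  "maximizes_L_raw l m w q \<longleftrightarrow>
     is_arg_max (L_raw l m w)
       (\<lambda>a. entries_in l m {0..1} a \<and> normalized l m a \<and> LR_ordered l m a) q"

end

theory Submission
  imports Defs
begin

text \<open>
  Write \<open>h\<^sub>j\<^sub>k = c\<^sub>j q\<^sub>j\<^sub>k\<close> with \<open>q\<close> satisfying (N). Scaling rows by positive factors preserves (LR), and
  \<open>L h = L\<^sub>r\<^sub>a\<^sub>w q + (\<Sum>\<^sub>j w\<^sub>j\<^sub>+ ln c\<^sub>j - n c\<^sub>j) + n\<close>. So the problem separates: each term in \<open>c\<^sub>j\<close> has the
  unique maximizer \<open>w\<^sub>j\<^sub>+ / n\<close>, independently of \<open>q\<close>. The matrices \<open>h\<close> with a zero row do not matter
  because they have \<open>L h = -\<infinity>\<close>.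
\<close>

lemma elog_neq_PInf [simp]: "elog x \<noteq> \<infinity>"
  by (simp add: elog_def)

lemma elog_mult_pos:
  assumes "0 < c"
  shows "elog (c * x) = ereal (ln c) + elog x"
  using assms by (auto simp: elog_def ln_mult zero_less_mult_iff)

lemma ereal_mult_elog_neq_PInf: "ereal (real a) * elog x \<noteq> \<infinity>"
  by (cases "a = 0") (auto simp: elog_def)

text \<open>For \<open>a = 0\<close> every product vanishes by the convention on
  \<open>0 * (-\<infinity>)\<close>. For positive \<open>a\<close> and \<open>x \<le> 0\<close> both
  sides are \<open>-\<infinity>\<close>, so no sign condition on \<open>x\<close> arises.\<close>

lemma ereal_mult_elog_scale:
  assumes "0 < c"
  shows "ereal (real a) * elog (c * x) = ereal (real a) * elog x + ereal (real a * ln c)"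
proof (cases "a = 0")
  case False
  then show ?thesis
    unfolding elog_mult_pos[OF assms] by (cases "0 < x") (auto simp: elog_def algebra_simps)
qed (simp add: zero_ereal_def[symmetric])

text \<open>In \<open>ereal\<close>, \<open>\<infinity> + (-\<infinity>)\<close> equals
  \<open>\<infinity>\<close>, so a summand \<open>-\<infinity>\<close> absorbs the others only if
  none of them is \<open>\<infinity>\<close>.\<close>

lemma sum_ereal_MInf:
  fixes f :: "'a \<Rightarrow> ereal"
  assumes "finite A" "i \<in> A" "f i = -\<infinity>" "\<And>j. j \<in> A \<Longrightarrow> f j \<noteq> \<infinity>"
  shows "sum f A = -\<infinity>"
proof -
  have "sum f (A - {i}) \<noteq> \<infinity>"
    using assms by (simp add: sum_Pinfty)
  then show ?thesis
    using assms by (simp add: sum.remove[of A i])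
qed

lemma L_raw_MInf:
  assumes "j \<in> {1..l}" "k \<in> {1..m}" "0 < w j k" "a j k \<le> 0"
  shows "L_raw l m w a = -\<infinity>"
proof -
  have row: "(\<Sum>k=1..m. ereal (real (w j k)) * elog (a j k)) = -\<infinity>"
    using assms ereal_mult_elog_neq_PInf
    by (intro sum_ereal_MInf[of _ k]) (auto simp: elog_def)
  show ?thesis
    unfolding L_raw_def
    using assms(1) row
    by (subst sum_ereal_MInf[of _ j]) (simp_all add: sum_Pinfty ereal_mult_elog_neq_PInf)
qed

lemma L_raw_neq_PInf: "L_raw l m w a \<noteq> \<infinity>"
  by (simp add: L_raw_def sum_Pinfty ereal_mult_elog_neq_PInf)

lemma L_raw_finite:
  assumes "\<And>j k. j \<in> {1..l} \<Longrightarrow> k \<in> {1..m} \<Longrightarrow> 0 < a j k"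
  shows "L_raw l m w a \<noteq> -\<infinity>"
proof -
  have "L_raw l m w a = (\<Sum>j=1..l. \<Sum>k=1..m. ereal (real (w j k) * ln (a j k)))"
    unfolding L_raw_def using assms by (intro sum.cong refl) (simp add: elog_def)
  then show ?thesis by simp
qed

lemma L_fun_MInf_iff: "L_fun l m w a = -\<infinity> \<longleftrightarrow> L_raw l m w a = -\<infinity>"
  using L_raw_neq_PInf[of l m w a] by (cases "L_raw l m w a") (auto simp: L_fun_def)

text \<open>The correction is a finite real, so the identity also covers
  \<open>L_raw l m w q = -\<infinity>\<close>. Summing the counts along row \<open>j\<close> gives
  the coefficient of \<open>ln (c j)\<close>.\<close>

lemma L_raw_scale_rows:
  assumes "\<And>j. j \<in> {1..l} \<Longrightarrow> 0 < c j"
  shows "L_raw l m w (\<lambda>j k. c j * q j k) =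
    L_raw l m w q + ereal (\<Sum>j=1..l. real (row_sum m w j) * ln (c j))"
proof -
  have "L_raw l m w (\<lambda>j k. c j * q j k) =
    (\<Sum>j=1..l. \<Sum>k=1..m. ereal (real (w j k)) * elog (q j k) + ereal (real (w j k) * ln (c j)))"
    unfolding L_raw_def by (intro sum.cong refl ereal_mult_elog_scale assms)
  also have "\<dots> = L_raw l m w q + ereal (\<Sum>j=1..l. \<Sum>k=1..m. real (w j k) * ln (c j))"
    by (simp add: sum.distrib L_raw_def)
  also have "(\<Sum>j=1..l. \<Sum>k=1..m. real (w j k) * ln (c j)) =
    (\<Sum>j=1..l. real (row_sum m w j) * ln (c j))"
    by (simp add: row_sum_def sum_distrib_right)
  finally show ?thesis .
qed

lemma total_sum_eq_sum_row_sum: "total_sum l m a = (\<Sum>j=1..l. row_sum m a j)"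
  by (simp add: total_sum_def row_sum_def)

lemma row_sum_scale_rows:
  fixes q :: "nat \<Rightarrow> nat \<Rightarrow> real"
  shows "row_sum m (\<lambda>j k. c j * q j k) j = c j * row_sum m q j"
  by (simp add: row_sum_def sum_distrib_left)

lemma L_fun_scale_rows:
  assumes "\<And>j. j \<in> {1..l} \<Longrightarrow> 0 < c j" and "normalized l m q"
  shows "L_fun l m w (\<lambda>j k. c j * q j k) = L_raw l m w q
    + ereal ((\<Sum>j=1..l. real (row_sum m w j) * ln (c j) - real (total_sum l m w) * c j)
        + real (total_sum l m w))"
proof -
  have "total_sum l m (\<lambda>j k. c j * q j k) = sum c {1..l}"
    using assms(2) by (simp add: total_sum_eq_sum_row_sum row_sum_scale_rows normalized_def)
  moreover have "L_raw l m w (\<lambda>j k. c j * q j k) =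
      L_raw l m w q + ereal (\<Sum>j=1..l. real (row_sum m w j) * ln (c j))"
    by (rule L_raw_scale_rows) (rule assms(1))
  ultimately show ?thesis
    using L_raw_neq_PInf[of l m w q] unfolding L_fun_def
    by (cases "L_raw l m w q") (simp_all add: sum_subtractf sum_distrib_left)
qed

text \<open>Each product in (LR) takes one entry from row \<open>j1\<close> and one from row
  \<open>j2\<close>, so both sides pick up the same factor \<open>c j1 * c j2\<close>.\<close>

lemma LR_ordered_scale_rows:
  assumes "\<And>j. j \<in> {1..l} \<Longrightarrow> 0 \<le> c j" and "LR_ordered l m a"
  shows "LR_ordered l m (\<lambda>j k. c j * a j k)"
  unfolding LR_ordered_def
proof (intro allI impI)
  fix j1 j2 k1 k2
  assume *: "1 \<le> j1 \<and> j1 < j2 \<and> j2 \<le> l \<and> 1 \<le> k1 \<and> k1 < k2 \<and> k2 \<le> m"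
  then have "a j1 k2 * a j2 k1 \<le> a j1 k1 * a j2 k2"
    using assms(2) unfolding LR_ordered_def by blast
  moreover have "0 \<le> c j1 * c j2"
    using * by (intro mult_nonneg_nonneg assms(1)) auto
  ultimately have "(c j1 * c j2) * (a j1 k2 * a j2 k1) \<le> (c j1 * c j2) * (a j1 k1 * a j2 k2)"
    by (rule mult_left_mono)
  then show "c j1 * a j1 k2 * (c j2 * a j2 k1) \<le> c j1 * a j1 k1 * (c j2 * a j2 k2)"
    by (simp add: ac_simps)
qed

text \<open>With \<open>x = c / (W / n)\<close> the gap between the two sides is
  \<open>W * (x - 1 - ln x)\<close>, which is nonnegative and vanishes only at
  \<open>x = 1\<close>.\<close>

lemma mult_ln_minus_linear_le:
  fixes W n c :: real
  assumes "0 < W" "0 < n" "0 < c"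
  shows "W * ln c - n * c \<le> W * ln (W / n) - n * (W / n)"
    and "W * ln c - n * c = W * ln (W / n) - n * (W / n) \<Longrightarrow> c = W / n"
proof -
  let ?x = "c / (W / n)"
  have x: "0 < ?x" using assms by simp
  have gap: "(W * ln (W / n) - n * (W / n)) - (W * ln c - n * c) = W * (?x - 1 - ln ?x)"
    unfolding ln_divide_pos[OF assms(3) divide_pos_pos[OF assms(1,2)]]
    using assms by (simp add: right_diff_distrib)
  show "W * ln c - n * c \<le> W * ln (W / n) - n * (W / n)"
    using gap ln_le_minus_one[OF x] assms mult_nonneg_nonneg[of W "?x - 1 - ln ?x"] by linarith
  assume "W * ln c - n * c = W * ln (W / n) - n * (W / n)"
  then have "ln ?x = ?x - 1" using gap assms by simp
  then have "?x = 1" using x by (intro ln_eq_minus_one)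
  then show "c = W / n" using assms by (simp add: field_simps)
qed

text \<open>Some cell of row \<open>j\<close> has a positive count. An entry 0 there would make
  \<open>L_raw\<close> equal to \<open>-\<infinity>\<close>.\<close>

lemma row_sum_pos_if_finite:
  assumes "0 < row_sum m w j" "j \<in> {1..l}" "entries_in l m {0..} h" "L_raw l m w h \<noteq> -\<infinity>"
  shows "0 < row_sum m h j"
proof -
  obtain k where k: "k \<in> {1..m}" "0 < w j k"
    using assms(1) unfolding row_sum_def by (metis gr0I sum.neutral less_irrefl)
  then have "0 < h j k"
    using L_raw_MInf[of j l k m w h] assms by force
  then show ?thesis
    unfolding row_sum_def using k assms by (intro sum_pos2[of _ k]) (auto simp: entries_in_def)
qed

lemma entries_in_unit_interval:
  assumes "entries_in l m {0..} q" "normalized l m q"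
  shows "entries_in l m {0..1} q"
  unfolding entries_in_def
proof (intro ballI)
  fix j k assume jk: "j \<in> {1..l}" "k \<in> {1..m}"
  then have "q j k \<le> row_sum m q j"
    unfolding row_sum_def using assms(1) by (intro member_le_sum) (auto simp: entries_in_def)
  then show "q j k \<in> {0..1}"
    using jk assms by (auto simp: entries_in_def normalized_def)
qed

theorem mainTheorem3:
  fixes l m n :: nat and w :: "nat \<Rightarrow> nat \<Rightarrow> nat"
  assumes "1 \<le> l" and "1 \<le> m"
    and "\<And>j. j \<in> {1..l} \<Longrightarrow> 0 < row_sum m w j"
    and "\<And>k. k \<in> {1..m} \<Longrightarrow> 0 < col_sum l w k"
    and "n = total_sum l m w"
  shows "(\<forall>h. maximizes_L l m w h \<longrightarrow>
            (\<forall>j\<in>{1..l}. row_sum m h j = real (row_sum m w j) / real n) \<and>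
            maximizes_L_raw l m w (\<lambda>j k. h j k / row_sum m h j)) \<and>
         (\<forall>q. maximizes_L_raw l m w q \<longrightarrow>
            maximizes_L l m w (\<lambda>j k. real (row_sum m w j) / real n * q j k))"
proof -
  define feas where "feas = (\<lambda>a. entries_in l m {0..} a \<and> LR_ordered l m a)"
  define feas1 where
    "feas1 = (\<lambda>a. entries_in l m {0..1} a \<and> normalized l m a \<and> LR_ordered l m a)"
  define p where "p j = real (row_sum m w j) / real n" for j
  \<comment> \<open>\<open>G\<close> collects the dependence of \<open>L_fun\<close> on the row
    sums; \<open>p\<close> will be its only maximizer among positive \<open>c\<close>, up to values
    outside \<open>{1..l}\<close>.\<close>
  define G where "G c = (\<Sum>j=1..l. real (row_sum m w j) * ln (c j) - real n * c j)" for c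

  have n_pos: "0 < n"
  proof -
    have "row_sum m w 1 \<le> n"
      unfolding assms(5) total_sum_eq_sum_row_sum using assms(1) by (intro member_le_sum) auto
    then show ?thesis using assms(1,3) by fastforce
  qed
  have p_pos: "0 < p j" if "j \<in> {1..l}" for j
    using assms(3)[OF that] n_pos by (simp add: p_def)

  have max_iff: "maximizes_L l m w h \<longleftrightarrow> feas h \<and> (\<forall>a. feas a \<longrightarrow> L_fun l m w a \<le> L_fun l m w h)" for h
    by (auto simp: maximizes_L_def is_arg_max_def feas_def not_less)
  have max_raw_iff:
    "maximizes_L_raw l m w q \<longleftrightarrow> feas1 q \<and> (\<forall>a. feas1 a \<longrightarrow> L_raw l m w a \<le> L_raw l m w q)" for q
    by (auto simp: maximizes_L_raw_def is_arg_max_def feas1_def not_less)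

  have L_scale: "L_fun l m w (\<lambda>j k. c j * q j k) = L_raw l m w q + ereal (G c + real n)"
    if "\<And>j. j \<in> {1..l} \<Longrightarrow> 0 < c j" "feas1 q" for c q
    using L_fun_scale_rows[of l c m q w] that by (simp add: G_def assms(5) feas1_def)
  have feas_scale: "feas (\<lambda>j k. c j * q j k)"
    if "\<And>j. j \<in> {1..l} \<Longrightarrow> 0 < c j" "feas1 q" for c q
    using that LR_ordered_scale_rows[of l c m q]
    by (auto simp: feas_def feas1_def entries_in_def less_imp_le)

  have G_le: "G c \<le> G p" if "\<And>j. j \<in> {1..l} \<Longrightarrow> 0 < c j" for c
    unfolding G_def p_def
    by (intro sum_mono mult_ln_minus_linear_le(1)) (use that assms(3) n_pos in auto)
  have G_eq: "c j = p j" if pos: "\<And>j. j \<in> {1..l} \<Longrightarrow> 0 < c j" and "G p \<le> G c" "j \<in> {1..l}" for c j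
  proof -
    let ?g = "\<lambda>c j. real (row_sum m w j) * ln (c j) - real n * c j"
    have le: "?g c i \<le> ?g p i" if "i \<in> {1..l}" for i
      unfolding p_def by (intro mult_ln_minus_linear_le(1)) (use pos that assms(3) n_pos in auto)
    \<comment> \<open>Termwise inequalities with equal totals must be equalities in every
      term.\<close>
    have "G c = G p" using G_le[of c] that by force
    then have "?g c j = ?g p j"
      unfolding G_def using le that(3) sum_mono_inv[of "?g c" "{1..l}" "?g p" j] by auto
    then show ?thesis
      unfolding p_def using mult_ln_minus_linear_le(2)[of "real (row_sum m w j)" "real n" "c j"]
        pos that(3) assms(3) n_pos by simp
  qed

  have decompose: "feas1 (\<lambda>j k. h j k / row_sum m h j)
      \<and> (\<forall>j\<in>{1..l}. 0 < row_sum m h j)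
      \<and> L_fun l m w h = L_raw l m w (\<lambda>j k. h j k / row_sum m h j) + ereal (G (row_sum m h) + real n)"
    if h: "feas h" and fin: "L_fun l m w h \<noteq> -\<infinity>" for h
  proof -
    let ?q = "\<lambda>j k. h j k / row_sum m h j"
    have pos: "0 < row_sum m h j" if "j \<in> {1..l}" for j
      using row_sum_pos_if_finite[of m w j l h] assms(3) that h fin
      by (simp add: feas_def L_fun_MInf_iff)
    have "normalized l m ?q"
      unfolding normalized_def
      using pos by (fastforce simp: row_sum_def sum_divide_distrib[symmetric])
    moreover have "entries_in l m {0..} ?q"
      using h pos by (auto simp: entries_in_def feas_def less_imp_le)
    moreover have "LR_ordered l m ?q"
      using LR_ordered_scale_rows[of l "\<lambda>j. 1 / row_sum m h j" m h] h pos
      by (simp add: feas_def less_imp_le)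
    ultimately have q: "feas1 ?q"
      by (simp add: feas1_def entries_in_unit_interval)
    have eq: "row_sum m h j * ?q j k = h j k" if "j \<in> {1..l}" for j k
      using pos[OF that] by simp
    \<comment> \<open>The two matrices are only known to agree in rows \<open>1..l\<close>, which
      are the only ones that the sums inspect.\<close>
    have "L_fun l m w h = L_fun l m w (\<lambda>j k. row_sum m h j * ?q j k)"
      unfolding L_fun_def L_raw_def total_sum_def using eq by simp
    also have "\<dots> = L_raw l m w ?q + ereal (G (row_sum m h) + real n)"
      using pos q by (rule L_scale)
    finally show ?thesis using q pos by blast
  qed

  \<comment> \<open>A competitor with finite value, which keeps the maximum away from
    \<open>-\<infinity>\<close>; constant entries give equality in (LR).\<close>
  have unif: "feas1 (\<lambda>j k. 1 / real m)"
    using assms(2)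
    by (auto simp: feas1_def entries_in_def normalized_def row_sum_def LR_ordered_def)
  have unif_fin: "L_raw l m w (\<lambda>j k. 1 / real m) \<noteq> -\<infinity>"
    using assms(2) by (intro L_raw_finite) simp

  have L_p: "L_fun l m w (\<lambda>j k. p j * q j k) = L_raw l m w q + ereal (G p + real n)"
    and feas_p: "feas (\<lambda>j k. p j * q j k)" if "feas1 q" for q
    using L_scale[of p q] feas_scale[of p q] p_pos that by blast+

  have part1: "(\<forall>j\<in>{1..l}. row_sum m h j = p j) \<and>
      maximizes_L_raw l m w (\<lambda>j k. h j k / row_sum m h j)" if max: "maximizes_L l m w h" for h
  proof -
    let ?q = "\<lambda>j k. h j k / row_sum m h j"
    have h: "feas h" and le: "L_fun l m w a \<le> L_fun l m w h" if "feas a" for a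
      using max that by (auto simp: max_iff)
    have scaled_le: "L_raw l m w q + ereal (G p + real n) \<le> L_fun l m w h" if "feas1 q" for q
      using le[OF feas_p] L_p that by simp
    have fin: "L_fun l m w h \<noteq> -\<infinity>"
      using scaled_le[OF unif] unif_fin by (cases "L_raw l m w (\<lambda>j k. 1 / real m)") auto
    note d = decompose[OF _ fin]
    have hf: "feas h" using max by (simp add: max_iff)
    have q: "feas1 ?q" and pos: "\<And>j. j \<in> {1..l} \<Longrightarrow> 0 < row_sum m h j"
      and L: "L_fun l m w h = L_raw l m w ?q + ereal (G (row_sum m h) + real n)"
      using d[OF hf] by auto
    have "\<bar>L_raw l m w ?q\<bar> \<noteq> \<infinity>"
      using L fin L_raw_neq_PInf[of l m w ?q] by auto
    \<comment> \<open>The competitor is \<open>h\<close> itself with its row sums changed to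
      \<open>p\<close>. The common value of \<open>L_raw\<close> is finite and cancels.\<close>
    then have "G p \<le> G (row_sum m h)"
      using scaled_le[OF q] L by (cases "L_raw l m w ?q") auto
    then have rows: "row_sum m h j = p j" if "j \<in> {1..l}" for j
      using G_eq[of "row_sum m h" j] pos that by blast
    then have "G (row_sum m h) = G p"
      by (simp add: G_def)
    \<comment> \<open>Any normalized \<open>a\<close>, scaled to row sums \<open>p\<close>, competes
      with \<open>h\<close>; the equal constants \<open>G p + n\<close> cancel.\<close>
    then have "L_raw l m w a \<le> L_raw l m w ?q" if "feas1 a" for a
      using scaled_le[OF that] L
      by (cases "L_raw l m w a"; cases "L_raw l m w ?q") auto
    then show ?thesis using rows q by (simp add: max_raw_iff)
  qed

  have part2: "maximizes_L l m w (\<lambda>j k. p j * q j k)" if max: "maximizes_L_raw l m w q" for q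
  proof -
    have q: "feas1 q" using max by (simp add: max_raw_iff)
    have "L_fun l m w a \<le> L_fun l m w (\<lambda>j k. p j * q j k)" if a: "feas a" for a
    \<comment> \<open>Matrices that cannot be normalized fall under the value
      \<open>-\<infinity>\<close>, where the bound is trivial. Otherwise the two summands of
      \<open>L_fun\<close> are bounded separately.\<close>
    proof (cases "L_fun l m w a = -\<infinity>")
      case False
      from decompose[OF a this] have a1: "feas1 (\<lambda>j k. a j k / row_sum m a j)"
        and pos: "\<And>j. j \<in> {1..l} \<Longrightarrow> 0 < row_sum m a j"
        and L: "L_fun l m w a =
          L_raw l m w (\<lambda>j k. a j k / row_sum m a j) + ereal (G (row_sum m a) + real n)"
        by auto
      have "L_raw l m w (\<lambda>j k. a j k / row_sum m a j) \<le> L_raw l m w q"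
        using max a1 by (simp add: max_raw_iff)
      moreover have "ereal (G (row_sum m a) + real n) \<le> ereal (G p + real n)"
        using G_le[of "row_sum m a"] pos by simp
      ultimately show ?thesis
        unfolding L L_p[OF q] by (rule add_mono)
    qed simp
    then show ?thesis using feas_p[OF q] by (simp add: max_iff)
  qed

  show ?thesis using part1 part2 by (auto simp: p_def)
qed

end
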